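(* Every Decision Polyamorous Scheduling instance $\mathcal{P}_d=(P,R,f)$ with poly density $d\le \frac14$ is schedulable, i.e. admits a valid schedule.
   Context: A Decision Polyamorous Scheduling (DPS) instance $\mathcal P_d=(P,R,f)$ consists of a finite simple undirected graph $(P,R)$ and integer frequencies $f:R\to\mathbb N$ (write $f_e=f(e)$). A schedule is a function $S:\mathbb N_0\to 2^R$. For $e\in R$, the recurrence time $r_S(e)$ is the supremum of $d+1$ over all $d\in\mathbb N$ for which there exists $t\in\mathbb N_0$ with $e\notin S(t)\cup\dots\cup S(t+d-1)$ (and $r_S(e)=1$ if no such $d$ exists). A schedule is valid for $\mathcal P_d$ if $S(t)$ is a matching of $(P,R)$ for every $t\in\mathbb N_0$ and $r_S(e)\le f(e)$ for all $e\in R$. Let $\mathcal M$ be the set of inclusion-maximal matchings of $(P,R)$ and $\mathcal Z$ the set of weightings $z:R\to[0,1]$ with $\sum_{e\in R} z_e=1$. The poly density of $\mathcal P_d$ is $d=\max_{z\in\mathcal Z} \left(\max_{M\in\mathcal M}\sum_{e\in M} z_e f_e\right)^{-1}$. *)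

theory Defs
  imports Complex_Main "HOL-Library.Extended_Nat"
begin

definition simple_graph :: "'a set \<Rightarrow> 'a set set \<Rightarrow> bool" where
  "simple_graph P R \<longleftrightarrow> (\<forall>e\<in>R. e \<subseteq> P \<and> card e = 2)"

text \<open>Frequencies are positive integers; the values of \<open>f\<close> outside \<open>R\<close> play no role.\<close>

definition dps_instance :: "'a set \<Rightarrow> 'a set set \<Rightarrow> ('a set \<Rightarrow> nat) \<Rightarrow> bool" where
  "dps_instance P R f \<longleftrightarrow> finite P \<and> simple_graph P R \<and> (\<forall>e\<in>R. 1 \<le> f e)"

definition matching :: "'a set set \<Rightarrow> 'a set set \<Rightarrow> bool" where
  "matching R M \<longleftrightarrow> M \<subseteq> R \<and> pairwise disjnt M"

definition maximal_matchings :: "'a set set \<Rightarrow> 'a set set set" where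
  "maximal_matchings R = {M. matching R M \<and> (\<forall>M'. matching R M' \<and> M \<subseteq> M' \<longrightarrow> M' = M)}"

text \<open>The recurrence time is infinite iff there are arbitrarily long gaps, hence the type
  \<^typ>\<open>enat\<close>.\<close>

definition gap_lengths :: "(nat \<Rightarrow> 'e set) \<Rightarrow> 'e \<Rightarrow> nat set" where
  "gap_lengths S e = {d. 1 \<le> d \<and> (\<exists>t. e \<notin> (\<Union>s\<in>{t..t + d - 1}. S s))}"

definition recurrence_time :: "(nat \<Rightarrow> 'e set) \<Rightarrow> 'e \<Rightarrow> enat" where
  "recurrence_time S e =
     (if gap_lengths S e = {} then 1 else (SUP d\<in>gap_lengths S e. enat (d + 1)))"

definition valid_schedule :: "'a set set \<Rightarrow> ('a set \<Rightarrow> nat) \<Rightarrow> (nat \<Rightarrow> 'a set set) \<Rightarrow> bool" where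
  "valid_schedule R f S \<longleftrightarrow>
     (\<forall>t. matching R (S t)) \<and> (\<forall>e\<in>R. recurrence_time S e \<le> enat (f e))"

definition schedulable :: "'a set set \<Rightarrow> ('a set \<Rightarrow> nat) \<Rightarrow> bool" where
  "schedulable R f \<longleftrightarrow> (\<exists>S. valid_schedule R f S)"

definition weightings :: "'e set \<Rightarrow> ('e \<Rightarrow> real) set" where
  "weightings R = {z. (\<forall>e\<in>R. 0 \<le> z e \<and> z e \<le> 1) \<and> (\<Sum>e\<in>R. z e) = 1}"

text \<open>The outer maximum ranges over an infinite set of weightings and is therefore written as a
  supremum. For an instance with \<open>R \<noteq> {}\<close> it is attained: the inner maximum is continuous in
  \<open>z\<close> and positive, since every edge lies in some maximal matching and \<open>f e \<ge> 1\<close>, and the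
  weightings, restricted to \<open>R\<close>, form a compact simplex.
  If \<open>R = {}\<close> there are no weightings, and the density is set to \<open>0\<close>.\<close>

definition poly_density :: "'a set set \<Rightarrow> ('a set \<Rightarrow> nat) \<Rightarrow> real" where
  "poly_density R f =
     (if R = {} then 0
      else (SUP z\<in>weightings R.
              inverse (MAX M\<in>maximal_matchings R. \<Sum>e\<in>M. z e * real (f e))))"

end

theory Submission imports Defs begin

text \<open>
  Putting the weight of \<open>z\<close> on the edges at one vertex \<open>v\<close>, proportionally to \<open>1 / f e\<close>, shows
  that density at most \<open>1/4\<close> bounds the sum of \<open>1 / f e\<close> over the edges at \<open>v\<close> by \<open>1/4\<close>. After
  rounding every \<open>f e\<close> down to a power of two these sums are at most \<open>1/2\<close>. Treat the edges in
  increasing order of the rounded period \<open>p\<close> and give each of them a residue class modulo \<open>p\<close>.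
  The classes of the adjacent edges treated before are unions of residue classes modulo \<open>p\<close>, and
  they cover a proportion less than \<open>1/2 + 1/2\<close> of the integers, so some class is still free.
\<close>

section \<open>Residue classes modulo powers of two\<close>

lemma card_residue_class_power2_le:
  fixes j k c :: nat
  assumes "j \<le> k"
  shows "card {r. r < 2 ^ k \<and> r mod 2 ^ j = c} \<le> 2 ^ (k - j)"
proof -
  have "{r. r < 2 ^ k \<and> r mod 2 ^ j = c} \<subseteq> (\<lambda>q. q * 2 ^ j + c) ` {..<2 ^ (k - j)}"
  proof
    fix r :: nat
    assume r: "r \<in> {r. r < 2 ^ k \<and> r mod 2 ^ j = c}"
    have "(2::nat) ^ k = 2 ^ (k - j) * 2 ^ j"
      using assms by (simp flip: power_add)
    then have "r div 2 ^ j < 2 ^ (k - j)"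
      using r by (auto intro: less_mult_imp_div_less)
    moreover have "r = (r div 2 ^ j) * 2 ^ j + c"
      using r div_mult_mod_eq[of r "2 ^ j"] by simp
    ultimately show "r \<in> (\<lambda>q. q * 2 ^ j + c) ` {..<2 ^ (k - j)}"
      by blast
  qed
  then have "card {r. r < 2 ^ k \<and> r mod 2 ^ j = c} \<le> card {..<(2::nat) ^ (k - j)}"
    by (intro surj_card_le) auto
  then show ?thesis by simp
qed

text \<open>Greedy choice in order of nondecreasing \<open>k\<close>: every period chosen earlier
  divides the current \<open>2 ^ k x\<close>. An earlier conflicting \<open>e'\<close> therefore
  blocks at most the fraction \<open>1 / 2 ^ k e'\<close> of the residues modulo
  \<open>2 ^ k x\<close>, and these fractions add up to less than 1.\<close>

lemma conflict_free_residues: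
  fixes k :: "'e \<Rightarrow> nat" and C :: "'e \<Rightarrow> 'e \<Rightarrow> bool"
  assumes "finite E" and sym: "symp C"
    and "\<And>e. e \<in> E \<Longrightarrow> (\<Sum>e' | e' \<in> E \<and> e' \<noteq> e \<and> C e e'. 1 / 2 ^ k e') < (1::real)"
  shows "\<exists>a. \<forall>e\<in>E. a e < 2 ^ k e \<and>
    (\<forall>e'\<in>E. e \<noteq> e' \<and> C e e' \<longrightarrow> (\<forall>t::nat. \<not> (t mod 2 ^ k e = a e \<and> t mod 2 ^ k e' = a e')))"
  using assms(1,3)
proof (induction E rule: finite_ranking_induct[where f = k])
  case empty
  then show ?case by simp
next
  case (insert x S)
  show ?case
  \<comment> \<open>The ranking induction provides \<open>k y \<le> k x\<close> for all
    \<open>y \<in> S\<close>, but not that \<open>x\<close> is new.\<close>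
  proof (cases "x \<in> S")
    case True
    then show ?thesis using insert.IH insert.prems by (simp add: insert_absorb)
  next
    case False
    have "(\<Sum>e' | e' \<in> S \<and> e' \<noteq> e \<and> C e e'. 1 / 2 ^ k e') < (1::real)" if "e \<in> S" for e
    proof -
      have "(\<Sum>e' | e' \<in> S \<and> e' \<noteq> e \<and> C e e'. 1 / 2 ^ k e')
          \<le> (\<Sum>e' | e' \<in> insert x S \<and> e' \<noteq> e \<and> C e e'. 1 / (2::real) ^ k e')"
        using insert.hyps by (intro sum_mono2) auto
      also have "\<dots> < 1" using insert.prems that by blast
      finally show ?thesis .
    qed
    then obtain a where a: "\<forall>e\<in>S. a e < 2 ^ k e \<and>
        (\<forall>e'\<in>S. e \<noteq> e' \<and> C e e' \<longrightarrow> (\<forall>t::nat. \<not> (t mod 2 ^ k e = a e \<and> t mod 2 ^ k e' = a e')))"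
      using insert.IH by blast
    define N where "N = {e' \<in> S. C x e'}"
    \<comment> \<open>The residues modulo \<open>2 ^ k x\<close> blocked by neighbours of
      \<open>x\<close>. The union bound below gives fewer than \<open>2 ^ k x\<close> of them, so a
      free residue \<open>b\<close> remains.\<close>
    define F where "F = (\<Union>e'\<in>N. {r::nat. r < 2 ^ k x \<and> r mod 2 ^ k e' = a e'})"
    have N: "finite N" using insert.hyps by (simp add: N_def)
    have "real (card F) \<le> real (\<Sum>e'\<in>N. card {r::nat. r < 2 ^ k x \<and> r mod 2 ^ k e' = a e'})"
      unfolding F_def using card_UN_le[OF N] by (simp only: of_nat_le_iff)
    also have "\<dots> \<le> (\<Sum>e'\<in>N. 2 ^ k x * (1 / 2 ^ k e'))"
      unfolding of_nat_sum
    proof (rule sum_mono)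
      fix e' assume "e' \<in> N"
      then have le: "k e' \<le> k x" using insert.hyps by (simp add: N_def)
      have "real (card {r::nat. r < 2 ^ k x \<and> r mod 2 ^ k e' = a e'}) \<le> real (2 ^ (k x - k e'))"
        using card_residue_class_power2_le[OF le] by (simp only: of_nat_le_iff)
      also have "\<dots> = 2 ^ (k x - k e')" by simp
      also have "\<dots> = 2 ^ k x * (1 / 2 ^ k e')"
        using power_diff[OF _ le, of "2::real"] by simp
      finally show "real (card {r::nat. r < 2 ^ k x \<and> r mod 2 ^ k e' = a e'})
          \<le> 2 ^ k x * (1 / 2 ^ k e')" .
    qed
    also have "\<dots> = 2 ^ k x * (\<Sum>e'\<in>N. 1 / 2 ^ k e')"
      by (simp only: sum_distrib_left)
    also have "\<dots> < 2 ^ k x"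
    proof -
      have "N = {e'. e' \<in> insert x S \<and> e' \<noteq> x \<and> C x e'}"
        using False by (auto simp: N_def)
      then have "(\<Sum>e'\<in>N. 1 / 2 ^ k e') < (1::real)"
        using insert.prems[of x] by simp
      then show ?thesis by simp
    qed
    finally have "real (card F) < real (2 ^ k x)" by simp
    then have "card F < card {..<(2::nat) ^ k x}" by (simp only: of_nat_less_iff card_lessThan)
    moreover have "finite F" unfolding F_def using N by auto
    ultimately obtain b where b: "b < 2 ^ k x" "b \<notin> F"
      by (metis card_mono lessThan_iff linorder_not_le subsetI)
    have free: "t mod 2 ^ k e' \<noteq> a e'" if "e' \<in> S" "C x e'" "t mod 2 ^ k x = b" for e' and t :: nat
    proof -
      \<comment> \<open>The residue of \<open>t\<close> modulo \<open>2 ^ k x\<close> determines its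
        residue modulo the divisor \<open>2 ^ k e'\<close>, so checking \<open>b\<close> alone
        settles all times \<open>t\<close>.\<close>
      have "b mod 2 ^ k e' \<noteq> a e'"
        using b that(1,2) by (auto simp: F_def N_def)
      moreover have "(2::nat) ^ k e' dvd 2 ^ k x"
        using insert.hyps that by (intro le_imp_power_dvd) auto
      ultimately show ?thesis
        using that(3) by (metis mod_mod_cancel)
    qed
    \<comment> \<open>The claim ranges over ordered pairs, so the new element also occurs as the
      second argument of \<open>C\<close>; symmetry reduces this to \<open>free\<close>.\<close>
    have free': "t mod 2 ^ k e' \<noteq> a e'" if "e' \<in> S" "C e' x" "t mod 2 ^ k x = b" for e' and t :: nat
      using free that sympD[OF sym] by blast
    show ?thesis
      by (rule exI[of _ "a(x := b)"]) (use a b free free' False in auto)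
  qed
qed

text \<open>Any \<open>p\<close> consecutive times include one with residue \<open>a\<close>, so a
  gap has length at most \<open>p - 1\<close>.\<close>

lemma recurrence_time_residue_class_le:
  fixes p a q :: nat
  assumes "a < p" "p \<le> q" and S: "\<And>t. t mod p = a \<Longrightarrow> e \<in> S t"
  shows "recurrence_time S e \<le> enat q"
proof -
  have gap: "d + 1 \<le> p" if d: "d \<in> gap_lengths S e" for d
  proof (rule ccontr)
    assume "\<not> d + 1 \<le> p"
    then have pd: "p \<le> d" by simp
    obtain t where t: "e \<notin> (\<Union>s\<in>{t..t + d - 1}. S s)"
      using d by (auto simp: gap_lengths_def)
    \<comment> \<open>The first time from \<open>t\<close> on with residue \<open>a\<close>; adding
      \<open>p\<close> keeps the natural subtraction from truncating.\<close>
    define s where "s = t + (a + p - t mod p) mod p"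
    have "s mod p = (t mod p + (a + p - t mod p)) mod p"
      by (simp add: s_def mod_simps)
    also have "\<dots> = a"
      using \<open>a < p\<close> mod_less_divisor[of p t] by (simp add: less_imp_le trans_le_add2)
    finally have "e \<in> S s" by (rule S)
    moreover have "(a + p - t mod p) mod p < p"
      using \<open>a < p\<close> by simp
    then have "s \<in> {t..t + d - 1}"
      using pd by (simp add: s_def)
    ultimately show False using t by blast
  qed
  show ?thesis
  proof (cases "gap_lengths S e = {}")
    \<comment> \<open>Without gaps the recurrence time is 1 by definition, and
      \<open>a < p \<le> q\<close> gives \<open>1 \<le> q\<close>.\<close>
    case True
    then show ?thesis
      using assms(1,2) by (simp add: recurrence_time_def one_enat_def)
  next
    case False
    have "enat (d + 1) \<le> enat q" if "d \<in> gap_lengths S e" for d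
      using gap[OF that] \<open>p \<le> q\<close> by simp
    then show ?thesis
      using False by (auto simp: recurrence_time_def intro!: SUP_least)
  qed
qed

section \<open>Maximal matchings and lower bounds on the poly density\<close>

lemma finite_maximal_matchings: "finite R \<Longrightarrow> finite (maximal_matchings R)"
  by (rule finite_subset[of _ "Pow R"]) (auto simp: maximal_matchings_def matching_def)

text \<open>Choose a maximal member of the finite family of matchings containing \<open>e\<close>.
  Any matching above it also contains \<open>e\<close>, so it is maximal among all
  matchings.\<close>

lemma ex_maximal_matching_containing:
  assumes "finite R" "e \<in> R"
  shows "\<exists>M\<in>maximal_matchings R. e \<in> M"
proof -
  define A where "A = {M. matching R M \<and> e \<in> M}"
  have "A \<subseteq> Pow R" by (auto simp: A_def matching_def)
  then have "finite A" using assms(1) by (simp add: finite_subset)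
  moreover have "{e} \<in> A" using assms(2) by (simp add: A_def matching_def)
  ultimately obtain M where "M \<in> A" "\<forall>M'\<in>A. M \<subseteq> M' \<longrightarrow> M = M'"
    using finite_has_maximal by (metis empty_iff)
  then show ?thesis
    unfolding A_def maximal_matchings_def by blast
qed

text \<open>Each \<open>z e\<close> is at most the maximum, because \<open>e\<close> lies in some
  maximal matching and \<open>f e \<ge> 1\<close>; summing over \<open>R\<close> gives the bound.
  Being positive and independent of \<open>z\<close>, it bounds the inverses in the density from
  above.\<close>

lemma max_matching_weight_ge:
  assumes "finite R" "R \<noteq> {}" "\<forall>e\<in>R. 1 \<le> f e" "z \<in> weightings R"
  shows "1 / real (card R) \<le> (MAX M\<in>maximal_matchings R. \<Sum>e\<in>M. z e * real (f e))"
    (is "_ \<le> ?m")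
proof -
  have z0: "0 \<le> z e" if "e \<in> R" for e
    using assms(4) that by (simp add: weightings_def)
  have "z e \<le> ?m" if e: "e \<in> R" for e
  proof -
    obtain M where M: "M \<in> maximal_matchings R" "e \<in> M"
      using ex_maximal_matching_containing assms(1) e by blast
    then have MR: "M \<subseteq> R" by (simp add: maximal_matchings_def matching_def)
    have "z e * 1 \<le> z e * real (f e)"
      using assms(3) e z0 by (intro mult_left_mono) auto
    also have "\<dots> \<le> (\<Sum>e\<in>M. z e * real (f e))"
      using MR M assms(1) z0 by (intro member_le_sum) (auto intro: finite_subset)
    also have "\<dots> \<le> ?m"
      using M finite_maximal_matchings[OF assms(1)] by (intro Max_ge) auto
    finally show ?thesis by simp
  qed
  then have "(\<Sum>e\<in>R. z e) \<le> real (card R) * ?m"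
    using sum_bounded_above by blast
  then have "1 \<le> real (card R) * ?m"
    using assms(4) by (simp add: weightings_def)
  moreover have "0 < real (card R)" using assms(1,2) by (simp add: card_gt_0_iff)
  ultimately show ?thesis by (simp add: field_simps)
qed

text \<open>A real supremum dominates its members only if the set is bounded above; here
  \<open>card R\<close> is a bound.\<close>

lemma inverse_max_matching_weight_le_poly_density:
  assumes "finite R" "R \<noteq> {}" "\<forall>e\<in>R. 1 \<le> f e" "z \<in> weightings R"
  shows "inverse (MAX M\<in>maximal_matchings R. \<Sum>e\<in>M. z e * real (f e)) \<le> poly_density R f"
proof -
  have pos: "0 < 1 / real (card R)" using assms(1,2) by (simp add: card_gt_0_iff)
  have "inverse (MAX M\<in>maximal_matchings R. \<Sum>e\<in>M. z e * real (f e)) \<le> inverse (1 / real (card R))"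
    if "z \<in> weightings R" for z
    using max_matching_weight_ge[OF assms(1-3) that] pos by (rule le_imp_inverse_le)
  then have "bdd_above ((\<lambda>z. inverse (MAX M\<in>maximal_matchings R. \<Sum>e\<in>M. z e * real (f e)))
      ` weightings R)"
    by (auto simp: bdd_above_def)
  then show ?thesis
    unfolding poly_density_def using assms(2,4) by (auto intro: cSUP_upper)
qed

text \<open>A matching contains at most one edge at \<open>v\<close>, and for the weighting
  \<open>z\<close> below each such edge has \<open>z e * f e = 1 / W\<close>. Hence the inner
  maximum is at most \<open>1 / W\<close>, and its inverse is at least \<open>W\<close>.\<close>

lemma star_weight_le_poly_density:
  assumes "finite R" "\<forall>e\<in>R. 1 \<le> f e" and ne: "{e \<in> R. v \<in> e} \<noteq> {}"
  shows "(\<Sum>e | e \<in> R \<and> v \<in> e. 1 / real (f e)) \<le> poly_density R f"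
proof -
  define E where "E = {e \<in> R. v \<in> e}"
  define W where "W = (\<Sum>e\<in>E. 1 / real (f e))"
  define z where "z e = (if e \<in> E then 1 / (real (f e) * W) else 0)" for e
  define m where "m = (MAX M\<in>maximal_matchings R. \<Sum>e\<in>M. z e * real (f e))"
  have E: "finite E" "E \<subseteq> R" "E \<noteq> {}" using assms by (auto simp: E_def)
  have f: "0 < real (f e)" if "e \<in> E" for e
    using assms(2) E that by fastforce
  have W: "0 < W" unfolding W_def using E f by (intro sum_pos) auto
  have z0: "0 \<le> z e" for e using W by (simp add: z_def)
  have "(\<Sum>e\<in>R. z e) = (\<Sum>e\<in>E. 1 / (real (f e) * W))"
    unfolding z_def using assms(1) E by (simp add: sum.If_cases Int_absorb1)
  also have "\<dots> = (\<Sum>e\<in>E. 1 / real (f e)) / W" by (simp add: sum_divide_distrib)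
  finally have z1: "(\<Sum>e\<in>R. z e) = 1" using W unfolding W_def[symmetric] by simp
  have "z e \<le> 1" if "e \<in> R" for e
    using member_le_sum[of e R z] z0 z1 assms(1) that by simp
  then have z: "z \<in> weightings R" using z0 z1 by (simp add: weightings_def)
  have "(\<Sum>e\<in>M. z e * real (f e)) \<le> 1 / W" if M: "M \<in> maximal_matchings R" for M
  proof -
    have MR: "M \<subseteq> R" "pairwise disjnt M"
      using M by (auto simp: maximal_matchings_def matching_def)
    have fin: "finite M" using MR assms(1) finite_subset by blast
    have "(\<Sum>e\<in>M. z e * real (f e)) = (\<Sum>e\<in>M. if e \<in> E then 1 / W else 0)"
      using f by (intro sum.cong) (fastforce simp: z_def)+
    also have "\<dots> = real (card (M \<inter> E)) * (1 / W)"
      using fin by (simp add: sum.If_cases)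
    also have "\<dots> \<le> 1 * (1 / W)"
    proof (intro mult_right_mono)
      \<comment> \<open>Both edges contain \<open>v\<close>, so they are not disjoint and must
        coincide in a matching.\<close>
      have "e = e'" if "e \<in> M \<inter> E" "e' \<in> M \<inter> E" for e e'
        using that MR(2) by (auto simp: E_def pairwise_def disjnt_iff)
      then show "real (card (M \<inter> E)) \<le> 1"
        using fin by (auto simp: card_le_Suc0_iff_eq)
    qed (use W in simp)
    finally show ?thesis by simp
  qed
  moreover have "maximal_matchings R \<noteq> {}"
    using ex_maximal_matching_containing assms(1) E by blast
  ultimately have "m \<le> 1 / W"
    unfolding m_def using finite_maximal_matchings[OF assms(1)] by simp
  moreover have "0 < m"
  proof -
    have "R \<noteq> {}" using E by auto
    then have "0 < 1 / real (card R)" using assms(1) by (simp add: card_gt_0_iff)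
    also have "\<dots> \<le> m"
      unfolding m_def using max_matching_weight_ge[OF assms(1) \<open>R \<noteq> {}\<close> assms(2) z] .
    finally show ?thesis .
  qed
  ultimately have "inverse (1 / W) \<le> inverse m" by (rule le_imp_inverse_le)
  also have "\<dots> \<le> poly_density R f"
    unfolding m_def using assms E z by (intro inverse_max_matching_weight_le_poly_density) auto
  finally show ?thesis by (simp add: W_def E_def)
qed

section \<open>Rounding the frequencies and assembling the schedule\<close>

theorem theorem2:
  fixes P :: "'a set" and R :: "'a set set" and f :: "'a set \<Rightarrow> nat"
  assumes "dps_instance P R f"
    and "poly_density R f \<le> 1 / 4"
  shows "schedulable R f"
proof -
  have "R \<subseteq> Pow P" "finite P" and c2: "\<forall>e\<in>R. card e = 2" and f1: "\<forall>e\<in>R. 1 \<le> f e"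
    using assms(1) by (auto simp: dps_instance_def simple_graph_def)
  then have fin: "finite R" by (simp add: finite_subset)
  have "\<forall>e\<in>R. \<exists>n. 2 ^ n \<le> f e \<and> f e < 2 ^ (n + 1)"
    using f1 ex_power_ivl1[of 2] by blast
  then obtain k where k: "\<And>e. e \<in> R \<Longrightarrow> 2 ^ k e \<le> f e" "\<And>e. e \<in> R \<Longrightarrow> f e < 2 ^ (k e + 1)"
    by metis
  have star: "(\<Sum>e' | e' \<in> R \<and> e' \<noteq> e \<and> v \<in> e'. 1 / 2 ^ k e') < (1 / 2 :: real)"
    if e: "e \<in> R" "v \<in> e" for e v
  proof -
    \<comment> \<open>Strictness comes from leaving out the positive term of \<open>e\<close>
      itself.\<close>
    have "(\<Sum>e' | e' \<in> R \<and> e' \<noteq> e \<and> v \<in> e'. 1 / 2 ^ k e')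
        < (\<Sum>e' | e' \<in> R \<and> v \<in> e'. 1 / (2 :: real) ^ k e')"
      using fin e by (intro sum_strict_mono2[of _ _ e]) auto
    \<comment> \<open>Rounding down to a power of two loses less than a factor 2, which turns the
      density bound 1/4 into 1/2 per vertex.\<close>
    also have "\<dots> \<le> (\<Sum>e' | e' \<in> R \<and> v \<in> e'. 2 * (1 / real (f e')))"
    proof (rule sum_mono)
      fix e' assume "e' \<in> {e' \<in> R. v \<in> e'}"
      then have e': "1 \<le> f e'" "f e' < 2 ^ (k e' + 1)" using k f1 by auto
      then have "real (f e') < real (2 ^ (k e' + 1))" by (simp only: of_nat_less_iff)
      then show "1 / 2 ^ k e' \<le> 2 * (1 / real (f e'))"
        using e'(1) by (simp add: field_simps)
    qed
    also have "\<dots> = 2 * (\<Sum>e' | e' \<in> R \<and> v \<in> e'. 1 / real (f e'))"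
      by (simp only: sum_distrib_left)
    also have "\<dots> \<le> 2 * (1 / 4)"
      using star_weight_le_poly_density[OF fin f1, of v] e assms(2) by fastforce
    finally show ?thesis by simp
  qed
  have "(\<Sum>e' | e' \<in> R \<and> e' \<noteq> e \<and> \<not> disjnt e e'. 1 / 2 ^ k e') < (1 :: real)"
    if e: "e \<in> R" for e
  proof -
    obtain u v where uv: "e = {u, v}"
      using c2 e by (auto simp: card_2_iff)
    define N where "N x = {e'. e' \<in> R \<and> e' \<noteq> e \<and> x \<in> e'}" for x
    have N: "finite (N x)" for x using fin by (simp add: N_def)
    \<comment> \<open>An edge adjacent to \<open>e\<close> meets one of its two endpoints, so the
      strict bound 1/2 is used twice.\<close>
    have "{e'. e' \<in> R \<and> e' \<noteq> e \<and> \<not> disjnt e e'} = N u \<union> N v"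
      by (auto simp: uv N_def disjnt_iff)
    then have "(\<Sum>e' | e' \<in> R \<and> e' \<noteq> e \<and> \<not> disjnt e e'. 1 / 2 ^ k e')
        \<le> (\<Sum>e'\<in>N u. 1 / 2 ^ k e') + (\<Sum>e'\<in>N v. 1 / (2 :: real) ^ k e')"
      using sum.union_inter[OF N N, of "\<lambda>e'. 1 / (2 :: real) ^ k e'" u v]
        sum_nonneg[of "N u \<inter> N v" "\<lambda>e'. 1 / (2 :: real) ^ k e'"] by simp
    also have "\<dots> < 1 / 2 + 1 / 2"
      unfolding N_def using e uv by (intro add_strict_mono star) auto
    finally show ?thesis by simp
  qed
  moreover have "symp (\<lambda>e e' :: 'a set. \<not> disjnt e e')"
    by (auto intro!: sympI dest: disjnt_sym)
  ultimately have "\<exists>a. \<forall>e\<in>R. a e < 2 ^ k e \<and> (\<forall>e'\<in>R. e \<noteq> e' \<and> \<not> disjnt e e' \<longrightarrow>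
      (\<forall>t::nat. \<not> (t mod 2 ^ k e = a e \<and> t mod 2 ^ k e' = a e')))"
    by (intro conflict_free_residues[OF fin])
  then obtain a where a: "\<And>e. e \<in> R \<Longrightarrow> a e < 2 ^ k e"
    "\<And>e e' t. e \<in> R \<Longrightarrow> e' \<in> R \<Longrightarrow> e \<noteq> e' \<Longrightarrow> \<not> disjnt e e'
      \<Longrightarrow> \<not> ((t::nat) mod 2 ^ k e = a e \<and> t mod 2 ^ k e' = a e')"
    by metis
  \<comment> \<open>Each edge meets exactly in its residue class, with period
    \<open>2 ^ k e \<le> f e\<close>; distinct intersecting edges never meet at the same time, so
    each \<open>S t\<close> is a matching.\<close>
  define S where "S t = {e \<in> R. t mod 2 ^ k e = a e}" for t :: nat
  have "matching R (S t)" for t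
    unfolding matching_def S_def pairwise_def using a(2) by blast
  moreover have "recurrence_time S e \<le> enat (f e)" if "e \<in> R" for e
    using a(1)[OF that] k(1)[OF that]
    by (rule recurrence_time_residue_class_le) (simp add: S_def that)
  ultimately show ?thesis
    by (auto simp: schedulable_def valid_schedule_def)
qed

end
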